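(* Let $k$ be a positive integer. If $G$ is a $2k$-connected $(P_2\cup kP_1)$-free graph with $\tau(G)>1$, then $G$ is hamiltonian-connected.
   Context: All graphs are finite and simple. For a graph $H$, a graph $G$ is $H$-free if $G$ contains no induced subgraph isomorphic to $H$. $P_n$ is the path on $n$ vertices, $P_1$ is a single vertex, and $P_2\cup kP_1$ is the disjoint union of an edge and $k$ isolated vertices. For a graph $G$, $c(G)$ is the number of components of $G$. The toughness of $G$ is $\tau(G)=\min\{|S|/c(G-S): S\subseteq V(G),\ c(G-S)\ge 2\}$ if $G$ is not complete, and $\tau(G)=\infty$ if $G$ is complete. A graph is hamiltonian-connected if for every two distinct vertices $a,b$ there is a path from $a$ to $b$ containing all vertices of the graph. *)

theory Defs
  imports Main "HOL-Library.Extended_Real"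
begin

definition simple_graph :: "'a set \<Rightarrow> ('a \<Rightarrow> 'a \<Rightarrow> bool) \<Rightarrow> bool" where
  "simple_graph V E \<longleftrightarrow> finite V \<and> (\<forall>u v. E u v \<longrightarrow> u \<in> V \<and> v \<in> V)
     \<and> (\<forall>u v. E u v \<longrightarrow> E v u) \<and> (\<forall>v. \<not> E v v)"

definition is_walk :: "('a \<Rightarrow> 'a \<Rightarrow> bool) \<Rightarrow> 'a list \<Rightarrow> bool" where
  "is_walk E xs \<longleftrightarrow> xs \<noteq> [] \<and> (\<forall>i. Suc i < length xs \<longrightarrow> E (xs ! i) (xs ! Suc i))"

definition reach_in :: "'a set \<Rightarrow> ('a \<Rightarrow> 'a \<Rightarrow> bool) \<Rightarrow> 'a \<Rightarrow> 'a \<Rightarrow> bool" where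
  "reach_in W E u v \<longleftrightarrow> (\<exists>xs. is_walk E xs \<and> set xs \<subseteq> W \<and> hd xs = u \<and> last xs = v)"

definition components_of :: "'a set \<Rightarrow> ('a \<Rightarrow> 'a \<Rightarrow> bool) \<Rightarrow> 'a set set" where
  "components_of W E = (\<lambda>v. {u \<in> W. reach_in W E v u}) ` W"

definition num_components :: "'a set \<Rightarrow> ('a \<Rightarrow> 'a \<Rightarrow> bool) \<Rightarrow> nat" where
  "num_components W E = card (components_of W E)"

definition connected_graph :: "'a set \<Rightarrow> ('a \<Rightarrow> 'a \<Rightarrow> bool) \<Rightarrow> bool" where
  "connected_graph W E \<longleftrightarrow> W \<noteq> {} \<and> (\<forall>u\<in>W. \<forall>v\<in>W. reach_in W E u v)"

definition k_connected :: "'a set \<Rightarrow> ('a \<Rightarrow> 'a \<Rightarrow> bool) \<Rightarrow> nat \<Rightarrow> bool" where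
  "k_connected V E k \<longleftrightarrow> card V > k \<and>
     (\<forall>S. S \<subseteq> V \<and> card S < k \<longrightarrow> connected_graph (V - S) E)"

definition complete_graph :: "'a set \<Rightarrow> ('a \<Rightarrow> 'a \<Rightarrow> bool) \<Rightarrow> bool" where
  "complete_graph V E \<longleftrightarrow> (\<forall>u\<in>V. \<forall>v\<in>V. u \<noteq> v \<longrightarrow> E u v)"

definition toughness :: "'a set \<Rightarrow> ('a \<Rightarrow> 'a \<Rightarrow> bool) \<Rightarrow> ereal" where
  "toughness V E = (if complete_graph V E then \<infinity> else
     Inf {ereal (real (card S) / real (num_components (V - S) E)) | S.
            S \<subseteq> V \<and> num_components (V - S) E \<ge> 2})"

definition has_induced :: "'a set \<Rightarrow> ('a \<Rightarrow> 'a \<Rightarrow> bool) \<Rightarrow> 'b set \<Rightarrow> ('b \<Rightarrow> 'b \<Rightarrow> bool) \<Rightarrow> bool" where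
  "has_induced V E VH EH \<longleftrightarrow> (\<exists>f. inj_on f VH \<and> f ` VH \<subseteq> V \<and>
     (\<forall>x\<in>VH. \<forall>y\<in>VH. E (f x) (f y) \<longleftrightarrow> EH x y))"

definition H_free :: "'a set \<Rightarrow> ('a \<Rightarrow> 'a \<Rightarrow> bool) \<Rightarrow> 'b set \<Rightarrow> ('b \<Rightarrow> 'b \<Rightarrow> bool) \<Rightarrow> bool" where
  "H_free V E VH EH \<longleftrightarrow> \<not> has_induced V E VH EH"

definition P2_kP1_V :: "nat \<Rightarrow> nat set" where
  "P2_kP1_V k = {0..k+1}"

definition P2_kP1_E :: "nat \<Rightarrow> nat \<Rightarrow> bool" where
  "P2_kP1_E x y \<longleftrightarrow> (x = 0 \<and> y = 1) \<or> (x = 1 \<and> y = 0)"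

definition hamiltonian_connected :: "'a set \<Rightarrow> ('a \<Rightarrow> 'a \<Rightarrow> bool) \<Rightarrow> bool" where
  "hamiltonian_connected V E \<longleftrightarrow> (\<forall>a\<in>V. \<forall>b\<in>V. a \<noteq> b \<longrightarrow>
     (\<exists>xs. is_walk E xs \<and> distinct xs \<and> set xs = V \<and> hd xs = a \<and> last xs = b))"

end

theory Submission
  imports Defs "HOL-Library.Multiset"
begin

text \<open>
  Let \<open>P\<close> be a longest \<open>a\<close>-\<open>b\<close> path and suppose that it misses a vertex. The successors on \<open>P\<close> of the
  neighbours of a component of \<open>G - P\<close> form an independent set of at least \<open>2k - 1\<close> vertices, none of
  them adjacent to the component; so the component has no edge and is a single vertex \<open>h\<close>. Let \<open>S\<close>
  consist of \<open>h\<close> and the successors of its neighbours. A vertex with a neighbour in \<open>S\<close> is adjacent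
  to all but at most \<open>k - 1\<close> vertices of \<open>S\<close>; let \<open>M\<close> be the set of these vertices. Its complement
  is independent, as an edge there together with \<open>k\<close> vertices of \<open>S\<close> would be an induced
  \<open>P\<^sub>2 \<union> kP\<^sub>1\<close>. Toughness then makes \<open>M\<close> larger than its complement. Since \<open>P\<close> contains \<open>M\<close> but
  not \<open>h\<close>, some two consecutive vertices of \<open>P\<close> lie in \<open>M\<close>. They share two neighbours among the
  successors of neighbours of \<open>h\<close>, and through these \<open>P\<close> can be rerouted to pick up \<open>h\<close>.
\<close>

section \<open>Walks\<close>

lemma is_walk_iff_successively: "is_walk E xs \<longleftrightarrow> xs \<noteq> [] \<and> successively E xs"
  by (auto simp: is_walk_def successively_conv_nth)

lemma is_walk_append:
  assumes "A \<noteq> []" "B \<noteq> []"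
  shows "is_walk E (A @ B) \<longleftrightarrow> is_walk E A \<and> is_walk E B \<and> E (last A) (hd B)"
  using assms by (auto simp: is_walk_iff_successively successively_append_iff)

lemma is_walk_rev:
  assumes "\<And>u v. E u v \<Longrightarrow> E v u"
  shows "is_walk E (rev xs) \<longleftrightarrow> is_walk E xs"
proof -
  have "E y x \<longleftrightarrow> E x y" for x y
    by (rule iffI; rule assms; assumption)
  then have "successively (\<lambda>x y. E y x) xs \<longleftrightarrow> successively E xs"
    by (rule successively_cong) (rule refl)
  then show ?thesis
    unfolding is_walk_iff_successively successively_rev rev_is_Nil_conv by (rule arg_cong)
qed

lemma is_walk_single [simp]: "is_walk E [x]"
  by (simp add: is_walk_def)

text \<open>Cutting out the closed detour between two visits to \<open>x\<close> shortens the walk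
  and keeps its ends.\<close>

lemma is_walk_imp_path:
  assumes "is_walk E xs"
  shows "\<exists>ys. is_walk E ys \<and> distinct ys \<and> set ys \<subseteq> set xs \<and> hd ys = hd xs \<and> last ys = last xs"
  using assms
proof (induction "length xs" arbitrary: xs rule: less_induct)
  case less
  show ?case
  proof (cases "distinct xs")
    case True
    with less.prems show ?thesis by blast
  next
    case False
    then obtain as bs cs x where xs: "xs = as @ [x] @ bs @ [x] @ cs"
      using not_distinct_decomp by blast
    let ?ys = "as @ [x] @ cs"
    have "is_walk E ?ys"
      using less.prems unfolding xs
      by (auto simp: is_walk_iff_successively successively_append_iff successively_Cons)
    moreover have "length ?ys < length xs" "set ?ys \<subseteq> set xs" "hd ?ys = hd xs" "last ?ys = last xs"
      by (auto simp: xs hd_append)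
    ultimately show ?thesis
      using less.hyps[of ?ys] by (metis subset_trans)
  qed
qed

lemma reach_in_refl: "v \<in> W \<Longrightarrow> reach_in W E v v"
  unfolding reach_in_def by (rule exI[of _ "[v]"]) simp

lemma reach_in_sym:
  assumes "\<And>u v. E u v \<Longrightarrow> E v u" "reach_in W E u v"
  shows "reach_in W E v u"
proof -
  obtain xs where "is_walk E xs" "set xs \<subseteq> W" "hd xs = u" "last xs = v"
    using assms(2) by (auto simp: reach_in_def)
  then show ?thesis
    unfolding reach_in_def
    by (intro exI[of _ "rev xs"]) (auto simp: is_walk_rev[OF assms(1)] hd_rev last_rev)
qed

lemma reach_in_trans:
  assumes "reach_in W E u v" "reach_in W E v w"
  shows "reach_in W E u w"
proof -
  obtain xs ys where xs: "is_walk E xs" "set xs \<subseteq> W" "hd xs = u" "last xs = v"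
    and ys: "is_walk E ys" "set ys \<subseteq> W" "hd ys = v" "last ys = w"
    using assms by (auto simp: reach_in_def)
  obtain zs where zs: "ys = v # zs"
    using ys by (cases ys) (auto simp: is_walk_def)
  have "is_walk E (xs @ zs)"
    using xs ys(1) unfolding zs
    by (auto simp: is_walk_iff_successively successively_append_iff successively_Cons)
  moreover have "set (xs @ zs) \<subseteq> W" "hd (xs @ zs) = u" "last (xs @ zs) = w"
    using xs ys zs by (auto simp: is_walk_def)
  ultimately show ?thesis
    unfolding reach_in_def by blast
qed

lemma reach_in_step:
  assumes "u \<in> W" "v \<in> W" "E u v"
  shows "reach_in W E u v"
  unfolding reach_in_def
  by (rule exI[of _ "[u, v]"]) (use assms in \<open>auto simp: is_walk_iff_successively\<close>)

lemma reach_in_subset: "reach_in W E u v \<Longrightarrow> u \<in> W \<and> v \<in> W"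
  by (metis hd_in_set is_walk_def last_in_set reach_in_def subsetD)

text \<open>This is how reachability is bounded from above: no walk inside \<open>W\<close> can
  leave a set that is closed under its edges.\<close>

lemma reach_in_closed:
  assumes "reach_in W E u v" "u \<in> C" and closed: "\<And>x y. x \<in> C \<Longrightarrow> y \<in> W \<Longrightarrow> E x y \<Longrightarrow> y \<in> C"
  shows "v \<in> C"
proof -
  obtain xs where "is_walk E xs" "set xs \<subseteq> W" "hd xs = u" "last xs = v"
    using assms(1) by (auto simp: reach_in_def)
  then show ?thesis
    using assms(2)
  proof (induction xs arbitrary: u)
    case Nil
    then show ?case by (simp add: is_walk_def)
  next
    case (Cons x xs)
    show ?case
    proof (cases xs)
      case Nil
      then show ?thesis using Cons.prems by simp
    next
      case (Cons y ys)
      then show ?thesis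
        using Cons.prems Cons.IH[of y] closed[of x y]
        by (auto simp: is_walk_iff_successively)
    qed
  qed
qed

section \<open>Toughness and the forbidden subgraph as counting bounds\<close>

lemma num_components_independent:
  assumes "\<And>u v. u \<in> I \<Longrightarrow> v \<in> I \<Longrightarrow> \<not> E u v"
  shows "num_components I E = card I"
proof -
  have "{u \<in> I. reach_in I E v u} = {v}" if "v \<in> I" for v
    using that assms reach_in_closed[of I E v _ "{v}"] by (auto simp: reach_in_refl)
  then have "components_of I E = (\<lambda>v. {v}) ` I"
    unfolding components_of_def by (intro image_cong) auto
  then show ?thesis
    by (simp add: num_components_def card_image)
qed

lemma toughness_gt_oneD:
  assumes "toughness V E > 1" "\<not> complete_graph V E" "S \<subseteq> V" "num_components (V - S) E \<ge> 2"
  shows "num_components (V - S) E < card S"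
proof -
  have "toughness V E \<le> ereal (real (card S) / real (num_components (V - S) E))"
    unfolding toughness_def using assms by (auto intro!: Inf_lower)
  then have "1 < ereal (real (card S) / real (num_components (V - S) E))"
    using assms(1) by order
  then show ?thesis
    using assms(4) by (simp add: one_ereal_def field_simps)
qed

lemma P2_kP1_free_card_less:
  assumes G: "simple_graph V E" and free: "H_free V E (P2_kP1_V k) P2_kP1_E"
    and uv: "E u v" and K: "K \<subseteq> V" "\<And>x y. x \<in> K \<Longrightarrow> y \<in> K \<Longrightarrow> \<not> E x y"
    and nuv: "\<And>s. s \<in> K \<Longrightarrow> \<not> E u s \<and> \<not> E v s"
  shows "card K < k"
proof (rule ccontr)
  assume "\<not> card K < k"
  then obtain K' where K': "K' \<subseteq> K" "card K' = k" "finite K'"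
    by (meson not_less obtain_subset_with_card_n)
  then obtain g where g: "bij_betw g {0..<k} K'"
    using ex_bij_betw_nat_finite[of K'] by auto
  have sym: "\<And>x y. E x y \<Longrightarrow> E y x" and irr: "\<And>x. \<not> E x x" and inV: "\<And>x y. E x y \<Longrightarrow> x \<in> V \<and> y \<in> V"
    using G by (auto simp: simple_graph_def)
  \<comment> \<open>The copy sends \<open>0\<close> and \<open>1\<close> to the ends of the edge and
    \<open>i + 2\<close> to the \<open>i\<close>-th chosen vertex of \<open>K\<close>.\<close>
  define f where "f i = (if i = 0 then u else if i = 1 then v else g (i - 2))" for i :: nat
  have P: "P2_kP1_V k = {0, 1} \<union> (\<lambda>i. i + 2) ` {0..<k}"
  proof -
    have "P2_kP1_V k = {0, 1} \<union> {0 + 2..<k + 2}"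
      by (auto simp: P2_kP1_V_def)
    then show ?thesis
      by (simp only: image_add_atLeastLessThan')
  qed
  have gK: "g i \<in> K" if "i < k" for i
    using that g K' by (auto simp: bij_betw_def)
  have ginj: "g i = g j \<longleftrightarrow> i = j" if "i < k" "j < k" for i j
    using that g by (auto simp: bij_betw_def inj_on_def)
  \<comment> \<open>\<open>u\<close> and \<open>v\<close> are adjacent to each other, while members
    of \<open>K\<close> are adjacent to neither.\<close>
  have neq: "g i \<noteq> u" "g i \<noteq> v" if "i < k" for i
    using gK[OF that] nuv uv sym by metis+
  have uvn: "u \<noteq> v"
    using uv irr by metis
  have "inj_on f (P2_kP1_V k)"
    unfolding P inj_on_def f_def using neq uvn ginj by (auto; metis)
  moreover have "f ` P2_kP1_V k \<subseteq> V"
    unfolding P f_def using inV[OF uv] gK subsetD[OF K(1)] by auto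
  moreover have "\<forall>x\<in>P2_kP1_V k. \<forall>y\<in>P2_kP1_V k. E (f x) (f y) \<longleftrightarrow> P2_kP1_E x y"
  proof -
    have gg: "\<not> E (g i) (g j)" "\<not> E u (g i)" "\<not> E v (g i)" "\<not> E (g i) u" "\<not> E (g i) v"
      if "i < k" "j < k" for i j
      using gK that K(2) nuv sym by blast+
    then show ?thesis
      unfolding P f_def P2_kP1_E_def using uv sym[OF uv] irr by auto
  qed
  ultimately show False
    using free unfolding H_free_def has_induced_def by blast
qed

section \<open>Cutting a list at one, two or three places\<close>

lemma list_split2:
  assumes "Suc i < length xs"
  obtains A B where "xs = A @ B" "length A = Suc i" "A \<noteq> []" "B \<noteq> []" "last A = xs ! i" "hd B = xs ! Suc i"
proof -
  have "last (take (Suc i) xs) = xs ! i"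
    using assms by (simp add: take_Suc_conv_app_nth)
  then show ?thesis
    using assms by (intro that[of "take (Suc i) xs" "drop (Suc i) xs"]) (auto simp: hd_drop_conv_nth)
qed

text \<open>A rerouting only needs the end vertices of the pieces; the lengths serve to place the
  next cut.\<close>

lemma list_split3:
  assumes "i < j" "Suc j < length xs"
  obtains A B C where "xs = A @ B @ C" "length A = Suc i" "length B = j - i" "A \<noteq> []" "B \<noteq> []" "C \<noteq> []"
    "last A = xs ! i" "hd B = xs ! Suc i" "last B = xs ! j" "hd C = xs ! Suc j"
proof -
  have "Suc i < length xs"
    using assms by simp
  then obtain A R where A: "xs = A @ R" "length A = Suc i" "A \<noteq> []" "R \<noteq> []" "last A = xs ! i" "hd R = xs ! Suc i"
    by (rule list_split2)
  obtain B C where B: "R = B @ C" "length B = j - i" "B \<noteq> []" "C \<noteq> []"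
    "last B = R ! (j - Suc i)" "hd C = R ! (j - i)"
  proof -
    have "Suc (j - Suc i) < length R"
      using A(1,2) assms by auto
    then show thesis
      using list_split2[of "j - Suc i" R] that assms(1) by (metis Suc_diff_Suc)
  qed
  show ?thesis
  proof (rule that[of A B C])
    show "last B = xs ! j" "hd C = xs ! Suc j"
      using A(1,2) B(5,6) assms(1) by (auto simp: nth_append)
  qed (use A B in auto)
qed

lemma list_split4:
  assumes "i < j" "j < l" "Suc l < length xs"
  obtains A B C D where "xs = A @ B @ C @ D" "A \<noteq> []" "B \<noteq> []" "C \<noteq> []" "D \<noteq> []"
    "last A = xs ! i" "hd B = xs ! Suc i" "last B = xs ! j" "hd C = xs ! Suc j"
    "last C = xs ! l" "hd D = xs ! Suc l"
proof -
  have "Suc j < length xs"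
    using assms by simp
  with assms(1) obtain A B R where A: "xs = A @ B @ R" "length A = Suc i" "length B = j - i"
    "A \<noteq> []" "B \<noteq> []" "R \<noteq> []"
    "last A = xs ! i" "hd B = xs ! Suc i" "last B = xs ! j" "hd R = xs ! Suc j"
    by (rule list_split3)
  obtain C D where C: "R = C @ D" "length C = l - j" "C \<noteq> []" "D \<noteq> []"
    "last C = R ! (l - Suc j)" "hd D = R ! (l - j)"
  proof -
    have "Suc (l - Suc j) < length R"
      using A(1-3) assms by auto
    then show thesis
      using list_split2[of "l - Suc j" R] that assms(2) by (metis Suc_diff_Suc)
  qed
  show ?thesis
  proof (rule that[of A B C D])
    show "last C = xs ! l" "hd D = xs ! Suc l"
      using A(1-3) C(5,6) assms(1,2) by (auto simp: nth_append)
  qed (use A C in auto)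
qed

section \<open>Rerouting a longest path\<close>

locale longest_path =
  fixes V :: "'a set" and E :: "'a \<Rightarrow> 'a \<Rightarrow> bool" and P :: "'a list"
  assumes simple: "simple_graph V E"
    and walk: "is_walk E P" and dist: "distinct P" and sub: "set P \<subseteq> V"
    and longest: "\<And>Q. is_walk E Q \<Longrightarrow> distinct Q \<Longrightarrow> set Q \<subseteq> V \<Longrightarrow> hd Q = hd P \<Longrightarrow> last Q = last P
      \<Longrightarrow> length Q \<le> length P"
begin

lemma E_sym: "E u v \<Longrightarrow> E v u" and E_irrefl: "\<not> E v v"
  and finite_V: "finite V"
  using simple by (auto simp: simple_graph_def)

text \<open>Every rerouting is refuted here. The multiset equation yields distinctness, containment
  in \<open>V\<close> and the length of \<open>Q\<close> at once, whatever the order and direction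
  of the pieces.\<close>

lemma no_longer_path:
  assumes "is_walk E Q" "mset Q = mset P + mset w" "hd Q = hd P" "last Q = last P"
    and w: "w \<noteq> []" "distinct w" "set w \<subseteq> V - set P"
  shows False
proof -
  have eq: "mset Q = mset (P @ w)"
    using assms(2) by simp
  have "distinct Q"
    using mset_eq_imp_distinct_iff[OF eq] dist w(2,3) by auto
  moreover have "set Q \<subseteq> V"
    using mset_eq_setD[OF eq] w(3) sub by auto
  ultimately have "length Q \<le> length P"
    using longest[of Q] assms(1,3,4) by simp
  then show False
    using mset_eq_length[OF eq] w(1) by simp
qed

text \<open>Since \<open>is_walk\<close> excludes the empty list, a detour has a vertex off
  \<open>P\<close>; a mere edge between the two positions does not count.\<close>

definition linked :: "nat \<Rightarrow> nat \<Rightarrow> bool" where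
  "linked i j \<longleftrightarrow> (\<exists>w. is_walk E w \<and> distinct w \<and> set w \<subseteq> V - set P
     \<and> E (P ! i) (hd w) \<and> E (last w) (P ! j))"

lemma not_linked_Suc:
  assumes "Suc i < length P"
  shows "\<not> linked i (Suc i)"
proof
  assume "linked i (Suc i)"
  then obtain w where w: "is_walk E w" "distinct w" "set w \<subseteq> V - set P"
    "E (P ! i) (hd w)" "E (last w) (P ! Suc i)"
    by (auto simp: linked_def)
  then have wn: "w \<noteq> []" by (simp add: is_walk_def)
  obtain A B where P: "P = A @ B" "A \<noteq> []" "B \<noteq> []" and e: "last A = P ! i" "hd B = P ! Suc i"
    by (rule list_split2[OF assms])
  show False
  proof (rule no_longer_path[of "A @ w @ B" w])
    show "is_walk E (A @ w @ B)"
      using walk w(1) w(4,5)[folded e] wn P(2,3) unfolding P(1) by (simp add: is_walk_append)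
  qed (use P(2-) w(2,3) wn in \<open>simp_all add: P(1)\<close>)
qed

text \<open>Otherwise \<open>P\<close> could take the detour from \<open>P ! i\<close> to
  \<open>P ! j\<close>, run backwards to \<open>P ! Suc i\<close> and cross to
  \<open>P ! Suc j\<close>.\<close>

lemma linked_successors_nonadjacent:
  assumes "i < j" "Suc j < length P" "linked i j"
  shows "\<not> E (P ! Suc i) (P ! Suc j)"
proof
  assume adj: "E (P ! Suc i) (P ! Suc j)"
  obtain w where w: "is_walk E w" "distinct w" "set w \<subseteq> V - set P"
    "E (P ! i) (hd w)" "E (last w) (P ! j)"
    using assms(3) by (auto simp: linked_def)
  then have wn: "w \<noteq> []" by (simp add: is_walk_def)
  obtain A B C where P: "P = A @ B @ C" "A \<noteq> []" "B \<noteq> []" "C \<noteq> []"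
    and e: "last A = P ! i" "hd B = P ! Suc i" "last B = P ! j" "hd C = P ! Suc j"
    by (rule list_split3[OF assms(1,2)])
  show False
  proof (rule no_longer_path[of "A @ w @ rev B @ C" w])
    show "is_walk E (A @ w @ rev B @ C)"
      using walk w(1) w(4,5)[folded e] adj[folded e] wn P(2-4) unfolding P(1)
      by (simp add: is_walk_append is_walk_rev E_sym hd_rev last_rev)
  qed (use P(2-) w(2,3) wn in \<open>simp_all add: P(1)\<close>)
qed

text \<open>The same exchange, with \<open>h\<close> as the detour and \<open>y\<close> in place of
  the edge between the successors.\<close>

lemma no_outside_common_neighbour:
  assumes "i < j" "Suc j < length P" "h \<in> V - set P" "y \<in> V - set P" "h \<noteq> y"
    and h: "E h (P ! i)" "E h (P ! j)" and y: "E y (P ! Suc i)" "E y (P ! Suc j)"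
  shows False
proof -
  obtain A B C where P: "P = A @ B @ C" "A \<noteq> []" "B \<noteq> []" "C \<noteq> []"
    and e: "last A = P ! i" "hd B = P ! Suc i" "last B = P ! j" "hd C = P ! Suc j"
    by (rule list_split3[OF assms(1,2)])
  show False
  proof (rule no_longer_path[of "A @ [h] @ rev B @ [y] @ C" "[h, y]"])
    show "is_walk E (A @ [h] @ rev B @ [y] @ C)"
      using walk h[folded e] y[folded e] P(2-4) unfolding P(1)
      by (auto simp del: append_Cons append_Nil simp: is_walk_append is_walk_rev E_sym hd_rev last_rev)
  qed (use P(2-) assms(3-5) in \<open>simp_all add: P(1)\<close>)
qed

text \<open>Drop the path edges after positions \<open>i\<close>, \<open>j\<close> and
  \<open>p\<close>. Then \<open>h\<close> joins \<open>P ! i\<close> to \<open>P ! j\<close>, and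
  the ends of the edge at \<open>p\<close> are joined to different successors: \<open>P ! p\<close>
  to \<open>P ! Suc i\<close> and \<open>P ! Suc p\<close> to \<open>P ! Suc j\<close>, or the other
  way round if \<open>p\<close> lies between \<open>i\<close> and \<open>j\<close>.\<close>

lemma no_common_successor_neighbours:
  assumes ij: "i < j" "Suc j < length P" and p: "Suc p < length P" "p \<noteq> i" "p \<noteq> j" and h: "h \<in> V - set P"
    and hi: "E h (P ! i)" and hj: "E h (P ! j)"
    and u: "E (P ! p) (P ! Suc i)" "E (P ! p) (P ! Suc j)"
    and v: "E (P ! Suc p) (P ! Suc i)" "E (P ! Suc p) (P ! Suc j)"
  shows False
proof -
  consider "j < p" | "p < i" | "i < p" "p < j"
    using p by linarith
  then show False
  proof cases
    case 1
    obtain A B C D where P: "P = A @ B @ C @ D" "A \<noteq> []" "B \<noteq> []" "C \<noteq> []" "D \<noteq> []"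
      and e: "last A = P ! i" "hd B = P ! Suc i" "last B = P ! j" "hd C = P ! Suc j"
      "last C = P ! p" "hd D = P ! Suc p"
      by (rule list_split4[OF ij(1) 1 p(1)])
    show False
    proof (rule no_longer_path[of "A @ [h] @ rev B @ rev C @ D" "[h]"])
      show "is_walk E (A @ [h] @ rev B @ rev C @ D)"
        using walk hi[folded e] hj[folded e] u[folded e] v[folded e] P(2-5) unfolding P(1)
        by (auto simp del: append_Cons append_Nil simp: is_walk_append is_walk_rev E_sym hd_rev last_rev)
    qed (use P(2-) h in \<open>simp_all add: P(1)\<close>)
  next
    case 2
    obtain A B C D where P: "P = A @ B @ C @ D" "A \<noteq> []" "B \<noteq> []" "C \<noteq> []" "D \<noteq> []"
      and e: "last A = P ! p" "hd B = P ! Suc p" "last B = P ! i" "hd C = P ! Suc i"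
      "last C = P ! j" "hd D = P ! Suc j"
      by (rule list_split4[OF 2 ij])
    show False
    proof (rule no_longer_path[of "A @ C @ [h] @ rev B @ D" "[h]"])
      show "is_walk E (A @ C @ [h] @ rev B @ D)"
        using walk hi[folded e] hj[folded e] u[folded e] v[folded e] P(2-5) unfolding P(1)
        by (auto simp del: append_Cons append_Nil simp: is_walk_append is_walk_rev E_sym hd_rev last_rev)
    qed (use P(2-) h in \<open>simp_all add: P(1)\<close>)
  next
    case 3
    obtain A B C D where P: "P = A @ B @ C @ D" "A \<noteq> []" "B \<noteq> []" "C \<noteq> []" "D \<noteq> []"
      and e: "last A = P ! i" "hd B = P ! Suc i" "last B = P ! p" "hd C = P ! Suc p"
      "last C = P ! j" "hd D = P ! Suc j"
      by (rule list_split4[OF 3 ij(2)])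
    show False
    proof (rule no_longer_path[of "A @ [h] @ rev C @ B @ D" "[h]"])
      show "is_walk E (A @ [h] @ rev C @ B @ D)"
        using walk hi[folded e] hj[folded e] u[folded e] v[folded e] P(2-5) unfolding P(1)
        by (auto simp del: append_Cons append_Nil simp: is_walk_append is_walk_rev E_sym hd_rev last_rev)
    qed (use P(2-) h in \<open>simp_all add: P(1)\<close>)
  qed
qed

text \<open>\<open>X\<close> lists the positions on \<open>P\<close> of the neighbours of the
  component of \<open>y\<close> off \<open>P\<close>. Deleting fewer than \<open>m\<close> vertices
  cannot cut this component off, and walks inside it link any two of the positions.\<close>

lemma card_attachment_indices:
  assumes conn: "k_connected V E m" and len: "Suc 0 < length P" and y: "y \<in> V - set P"
    and X: "X = {i. i < length P \<and> (\<exists>h. reach_in (V - set P) E y h \<and> E h (P ! i))}"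
  shows "m \<le> card X" "\<And>i j. i \<in> X \<Longrightarrow> j \<in> X \<Longrightarrow> linked i j"
proof -
  let ?R = "reach_in (V - set P) E"
  show linked: "linked i j" if ij: "i \<in> X" "j \<in> X" for i j
  proof -
    obtain h h' where h: "?R y h" "E h (P ! i)" "?R y h'" "E h' (P ! j)"
      using ij X by auto
    have "?R h h'"
      using reach_in_trans[OF reach_in_sym[OF E_sym h(1)] h(3)] .
    then obtain w where "is_walk E w" "set w \<subseteq> V - set P" "hd w = h" "last w = h'"
      by (auto simp: reach_in_def)
    then obtain w' where "is_walk E w'" "distinct w'" "set w' \<subseteq> V - set P" "hd w' = h" "last w' = h'"
      using is_walk_imp_path[of E w] by auto
    then show ?thesis
      using h E_sym unfolding linked_def by blast
  qed
  show "m \<le> card X"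
  proof (rule ccontr)
    assume "\<not> m \<le> card X"
    define N where "N = (!) P ` X"
    have NP: "N \<subseteq> set P"
      unfolding N_def X by auto
    have "card N < m"
      using \<open>\<not> m \<le> card X\<close> card_image_le[of X "(!) P"] by (auto simp: N_def X)
    then have con: "connected_graph (V - N) E"
      using conn NP sub unfolding k_connected_def by blast
    show False
    proof (cases "set P \<subseteq> N")
      \<comment> \<open>Here no vertex of \<open>P\<close> remains to be separated from
        \<open>y\<close>, but the first two positions are both attached and hence linked.\<close>
      case True
      have "inj_on ((!) P) {..<length P}"
        using dist by (simp add: inj_on_nth)
      then have "i \<in> X" if "i < length P" for i
        using True that nth_mem[OF that] unfolding N_def X by (force simp: inj_on_def)
      then have "0 \<in> X" "Suc 0 \<in> X"
        using len by (metis Suc_lessD)+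
      then have "linked 0 (Suc 0)"
        by (rule linked)
      then show False
        using not_linked_Suc len by blast
    next
      case False
      then obtain p where p: "p \<in> set P" "p \<notin> N" by blast
      have "reach_in (V - N) E y p"
        using con p sub y NP unfolding connected_graph_def by blast
      \<comment> \<open>A step from the component onto \<open>P\<close> would land in
        \<open>N\<close>, so the component is closed under the edges of
        \<open>V - N\<close>.\<close>
      then have "p \<in> {v. ?R y v}"
      proof (rule reach_in_closed)
        show "y \<in> {v. ?R y v}"
          using y by (simp add: reach_in_refl)
      next
        fix a b
        assume a: "a \<in> {v. ?R y v}" and b: "b \<in> V - N" and ab: "E a b"
        have "b \<notin> set P"
        proof
          assume "b \<in> set P"
          then obtain i where "i < length P" "b = P ! i"
            by (auto simp: in_set_conv_nth)
          then have "b \<in> N"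
            using a ab unfolding N_def X by blast
          then show False using b by simp
        qed
        moreover have "a \<in> V - set P"
          using a reach_in_subset by fastforce
        ultimately show "b \<in> {v. ?R y v}"
          using a b ab reach_in_trans[of "V - set P" E y a b] reach_in_step[of a "V - set P" b E] by auto
      qed
      then show False
        using p reach_in_subset by fastforce
    qed
  qed
qed

text \<open>Only the last vertex of \<open>P\<close> lacks a successor, hence the loss of at most
  one.\<close>

lemma successors_of_linked:
  assumes X: "X \<subseteq> {..<length P}" and linked: "\<And>i j. i \<in> X \<Longrightarrow> j \<in> X \<Longrightarrow> linked i j"
    and T: "T = {i \<in> X. Suc i < length P}" and K: "K = (\<lambda>i. P ! Suc i) ` T"
  shows "card X \<le> Suc (card K)" "inj_on (\<lambda>i. P ! Suc i) T" "\<And>u v. u \<in> K \<Longrightarrow> v \<in> K \<Longrightarrow> \<not> E u v"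
proof -
  have fin: "finite X"
    using X finite_subset by auto
  show inj: "inj_on (\<lambda>i. P ! Suc i) T"
    using dist unfolding T by (auto simp: inj_on_def nth_eq_iff_index_eq)
  have "X \<subseteq> insert (length P - 1) T"
    using X unfolding T by auto
  then have "card X \<le> Suc (card T)"
    using fin card_mono[of "insert (length P - 1) T" X] card_insert_le_m1[of "Suc (card T)" T "length P - 1"]
    unfolding T by fastforce
  then show "card X \<le> Suc (card K)"
    unfolding K card_image[OF inj] .
  show "\<not> E u v" if K_uv: "u \<in> K" "v \<in> K" for u v
  proof
    assume uv: "E u v"
    obtain i j where i: "i \<in> T" "j \<in> T" "u = P ! Suc i" "v = P ! Suc j"
      using K_uv unfolding K by blast
    have "i \<noteq> j"
      using uv i E_irrefl by auto
    then show False
      using linked_successors_nonadjacent[of i j] linked_successors_nonadjacent[of j i] i uv E_sym linked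
      unfolding T by (cases i j rule: linorder_cases) auto
  qed
qed

text \<open>A vertex of the component of \<open>y\<close> adjacent to a successor would link
  consecutive positions. So an edge at \<open>y\<close> would be compatible with all of the at least
  \<open>2 * k - 1 \<ge> k\<close> successors.\<close>

lemma outside_independent:
  assumes k: "k \<ge> 1" "k_connected V E (2 * k)" and free: "H_free V E (P2_kP1_V k) P2_kP1_E"
    and len: "Suc 0 < length P" and yz: "y \<in> V - set P" "z \<in> V - set P"
  shows "\<not> E y z"
proof
  assume adj: "E y z"
  let ?R = "reach_in (V - set P) E"
  define X where "X = {i. i < length P \<and> (\<exists>h. ?R y h \<and> E h (P ! i))}"
  define T where "T = {i \<in> X. Suc i < length P}"
  define K where "K = (\<lambda>i. P ! Suc i) ` T"
  note X = card_attachment_indices[OF k(2) len yz(1) X_def]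
  have X_sub: "X \<subseteq> {..<length P}"
    by (auto simp: X_def)
  note succ = successors_of_linked[OF X_sub X(2) T_def K_def]
  have nonadj: "\<not> E h s" if "?R y h" "s \<in> K" for h s
  proof
    assume "E h s"
    obtain i where i: "i \<in> T" "s = P ! Suc i"
      using \<open>s \<in> K\<close> unfolding K_def by auto
    then have "Suc i \<in> X"
      using \<open>E h s\<close> that(1) unfolding T_def X_def by auto
    then show False
      using X(2)[of i "Suc i"] i not_linked_Suc unfolding T_def by auto
  qed
  have "?R y y" "?R y z"
    using yz adj by (auto intro: reach_in_refl reach_in_step)
  then have "card K < k"
    using sub by (intro P2_kP1_free_card_less[OF simple free adj]) (auto simp: nonadj succ(3), auto simp: K_def T_def)
  then show False
    using succ(1) X(1) k(1) by linarith
qed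

end

lemma two_le_cardE:
  assumes "2 \<le> card A"
  obtains x y where "x \<in> A" "y \<in> A" "x \<noteq> y"
  using assms by (metis card_2_iff insert_subset obtain_subset_with_card_n)

text \<open>Each element satisfying \<open>Q\<close>, except possibly the head, is preceded by one
  that does not.\<close>

lemma length_filter_no_adjacent:
  assumes "\<And>i. Suc i < length xs \<Longrightarrow> \<not> (Q (xs ! i) \<and> Q (xs ! Suc i))"
  shows "length (filter Q xs) \<le> length (filter (\<lambda>x. \<not> Q x) xs) + (if xs \<noteq> [] \<and> Q (hd xs) then 1 else 0)"
  using assms
proof (induction xs)
  case Nil
  then show ?case by simp
next
  case (Cons x xs)
  have IH: "length (filter Q xs) \<le> length (filter (\<lambda>x. \<not> Q x) xs) + (if xs \<noteq> [] \<and> Q (hd xs) then 1 else 0)"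
    using Cons.prems by (intro Cons.IH) force
  have "\<not> (Q x \<and> Q (hd xs))" if "xs \<noteq> []"
    using Cons.prems[of 0] that by (simp add: hd_conv_nth)
  then show ?case
    using IH by (auto split: if_splits)
qed

section \<open>Contradiction from a missed vertex\<close>

context longest_path
begin

lemma tough_imp_hamiltonian:
  assumes k: "k \<ge> 1" "k_connected V E (2 * k)" and free: "H_free V E (P2_kP1_V k) P2_kP1_E"
    and tough: "toughness V E > 1" and len: "Suc 0 < length P"
  shows "set P = V"
proof (rule ccontr)
  assume "set P \<noteq> V"
  then obtain h where h: "h \<in> V - set P"
    using sub by auto
  note outside = outside_independent[OF k free len]
  define X where "X = {i. i < length P \<and> E h (P ! i)}"
  \<comment> \<open>\<open>h\<close> is isolated off \<open>P\<close>, so the attachments of its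
    component are just its neighbours.\<close>
  have reach_h: "reach_in (V - set P) E h v \<longleftrightarrow> v = h" for v
    using h outside reach_in_closed[of "V - set P" E h v "{h}"] reach_in_subset[of "V - set P" E h v]
    by (auto simp: reach_in_refl)
  have X': "X = {i. i < length P \<and> (\<exists>h'. reach_in (V - set P) E h h' \<and> E h' (P ! i))}"
    by (simp add: X_def reach_h)
  define T where "T = {i \<in> X. Suc i < length P}"
  define K where "K = (\<lambda>i. P ! Suc i) ` T"
  define S where "S = insert h K"
  note X = card_attachment_indices[OF k(2) len h X']
  have X_sub: "X \<subseteq> {..<length P}"
    by (auto simp: X_def)
  note succ = successors_of_linked[OF X_sub X(2) T_def K_def]
  have finT: "finite T"
    using X_sub finite_subset[of T "{..<length P}"] by (auto simp: T_def)
  have KP: "K \<subseteq> set P"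
    by (auto simp: K_def T_def)
  have hK: "\<not> E h s" if sK: "s \<in> K" for s
  proof
    assume "E h s"
    then obtain i where i: "i \<in> T" "Suc i \<in> X"
      using sK by (auto simp: K_def T_def X_def)
    then show False
      using X(2)[of i "Suc i"] not_linked_Suc by (auto simp: T_def)
  qed
  have finK: "finite K"
    using finT by (simp add: K_def)
  have cardK: "card K = card T"
    unfolding K_def by (rule card_image[OF succ(2)])
  have "h \<notin> K"
    using h KP by blast
  then have cardS: "card S = Suc (card K)" and finS: "finite S" and SV: "S \<subseteq> V"
    using finK h KP sub by (auto simp: S_def)
  have indepS: "\<not> E u v" if "u \<in> S" "v \<in> S" for u v
    using that hK succ(3) E_sym E_irrefl unfolding S_def by blast

  define M where "M = {v \<in> V. \<exists>s\<in>S. E v s}"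
  define I where "I = V - M"
  have MV: "M \<subseteq> V" by (auto simp: M_def)
  have SI: "S \<subseteq> I"
    using SV indepS by (auto simp: I_def M_def)
  \<comment> \<open>As \<open>S\<close> is independent, the members of \<open>S\<close> not adjacent
    to \<open>v\<close> are not adjacent to \<open>s\<close> either; apply the forbidden subgraph to
    the edge from \<open>v\<close> to \<open>s\<close>.\<close>
  have M_few: "card {s \<in> S. \<not> E v s} < k" if v: "v \<in> M" for v
  proof -
    obtain s where s: "s \<in> S" "E v s"
      using v by (auto simp: M_def)
    show ?thesis
      using SV s indepS by (intro P2_kP1_free_card_less[OF simple free s(2)]) auto
  qed
  \<comment> \<open>No end of such an edge has a neighbour in \<open>S\<close>, and
    \<open>card S \<ge> 2 * k\<close>.\<close>
  have indepI: "\<not> E u v" if "u \<in> I" "v \<in> I" for u v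
  proof
    assume uv: "E u v"
    have "card S < k"
      using SV indepS that by (intro P2_kP1_free_card_less[OF simple free uv]) (auto simp: I_def M_def)
    then show False
      using cardS succ(1) X(1) by linarith
  qed
  have cardSI: "card S \<le> card I"
    using SI finite_V by (intro card_mono) (auto simp: I_def)
  then have I2: "2 \<le> card I"
    using cardS succ(1) X(1) k(1) by linarith
  have "\<not> complete_graph V E"
  proof
    assume "complete_graph V E"
    moreover obtain u v where "u \<in> I" "v \<in> I" "u \<noteq> v"
      using two_le_cardE[OF I2] .
    ultimately show False
      using indepI by (auto simp: complete_graph_def I_def)
  qed
  \<comment> \<open>Deleting \<open>M\<close> leaves \<open>I\<close>, whose vertices are the
    components.\<close>
  then have cardM: "card I < card M"
    using toughness_gt_oneD[OF tough _ MV] I2 num_components_independent[OF indepI, of I] by (simp add: I_def)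

  \<comment> \<open>Of the at most \<open>k - 1\<close> non-neighbours in \<open>S\<close>, one is
    used up by \<open>h\<close> if \<open>v\<close> is not adjacent to it. The counts below depend
    on this saving.\<close>
  have few_T: "card {i \<in> T. \<not> E v (P ! Suc i)} + (if E v h then 0 else 1) < k" if v: "v \<in> M" for v
  proof -
    let ?A = "{i \<in> T. \<not> E v (P ! Suc i)}"
    have inj: "inj_on (\<lambda>i. P ! Suc i) ?A"
      using succ(2) by (rule inj_on_subset) auto
    have eq: "{s \<in> S. \<not> E v s} = (if E v h then {} else {h}) \<union> (\<lambda>i. P ! Suc i) ` ?A"
      by (auto simp: S_def K_def)
    have "h \<notin> (\<lambda>i. P ! Suc i) ` ?A"
      using h KP by (auto simp: K_def)
    then have "card {s \<in> S. \<not> E v s} = (if E v h then 0 else 1) + card ?A"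
      unfolding eq using finT card_image[OF inj] by simp
    then show ?thesis
      using M_few[OF v] by auto
  qed
  \<comment> \<open>Both remaining exchanges need two positions \<open>i < j\<close> in a subset
    \<open>T'\<close> of \<open>T\<close>; the count guarantees them.\<close>
  have two_common: False
    if "T' \<subseteq> T" "card (T - T') + 2 \<le> card T"
      and no_pair: "\<And>i j. i \<in> T' \<Longrightarrow> j \<in> T' \<Longrightarrow> i < j \<Longrightarrow> False" for T'
  proof -
    have "2 \<le> card T'"
      using that(1,2) finT card_Diff_subset[of T' T] finite_subset[of T' T] card_mono[of T T'] by linarith
    then obtain i j where "i \<in> T'" "j \<in> T'" "i \<noteq> j"
      by (rule two_le_cardE)
    then show False
      using no_pair by (meson linorder_neqE_nat)
  qed
  have T_large: "2 * k - 1 \<le> card T"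
    using succ(1) X(1) cardK by linarith

  \<comment> \<open>A vertex of \<open>M\<close> off \<open>P\<close> is not adjacent to
    \<open>h\<close>, so it misses at most \<open>k - 2\<close> of the \<open>2 * k - 1\<close> or
    more successors.\<close>
  have MP: "M \<subseteq> set P"
  proof
    fix y
    assume y: "y \<in> M"
    show "y \<in> set P"
    proof (rule ccontr)
      assume nP: "y \<notin> set P"
      then have yo: "y \<in> V - set P"
        using y MV by auto
      have yh: "h \<noteq> y"
        using y SI by (auto simp: I_def S_def)
      let ?T = "{i \<in> T. E y (P ! Suc i)}"
      have "T - ?T = {i \<in> T. \<not> E y (P ! Suc i)}"
        by auto
      then have few: "card (T - ?T) + 1 < k"
        using few_T[OF y] outside[OF yo h] by simp
      show False
      proof (rule two_common)
        show "card (T - ?T) + 2 \<le> card T"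
          using few T_large by linarith
        show False if "i \<in> ?T" "j \<in> ?T" "i < j" for i j
          using no_outside_common_neighbour[OF that(3) _ h yo yh] that by (auto simp: T_def X_def)
      qed auto
    qed
  qed

  \<comment> \<open>Otherwise \<open>card M\<close> exceeds the number of other vertices on
    \<open>P\<close> by at most one. These lie in \<open>I\<close> without \<open>h\<close>, so
    \<open>card M \<le> card I\<close>.\<close>
  have "\<exists>p. Suc p < length P \<and> P ! p \<in> M \<and> P ! Suc p \<in> M"
  proof (rule ccontr)
    assume "\<not> ?thesis"
    then have "length (filter (\<lambda>x. x \<in> M) P) \<le> length (filter (\<lambda>x. x \<notin> M) P) + 1"
      using length_filter_no_adjacent[of P "\<lambda>x. x \<in> M"] by (auto split: if_splits)
    moreover have "length (filter (\<lambda>x. x \<in> M) P) = card M"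
      using MP dist by (simp add: distinct_card[symmetric] Int_def[symmetric] Int_absorb1 Collect_conj_eq)
    moreover have "length (filter (\<lambda>x. x \<notin> M) P) = card (set (filter (\<lambda>x. x \<notin> M) P))"
      using dist distinct_card[of "filter (\<lambda>x. x \<notin> M) P"] by simp
    moreover have "card (set (filter (\<lambda>x. x \<notin> M) P)) < card I"
    proof (rule psubset_card_mono)
      show "finite I" using finite_V by (simp add: I_def)
      show "set (filter (\<lambda>x. x \<notin> M) P) \<subset> I"
        using h SI sub by (auto simp: I_def S_def)
    qed
    ultimately show False
      using cardM by linarith
  qed
  then obtain p where p: "Suc p < length P" "P ! p \<in> M" "P ! Suc p \<in> M"
    by blast
  \<comment> \<open>If \<open>p\<close> were in \<open>T\<close>, then \<open>P ! Suc p\<close>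
    would lie in \<open>K\<close>, hence in \<open>I\<close>. So \<open>P ! p\<close> is not
    adjacent to \<open>h\<close>, and \<open>p\<close> differs from the positions \<open>i\<close>,
    \<open>j\<close> chosen below.\<close>
  have pT: "p \<notin> T"
    using p(3) SI by (auto simp: I_def S_def K_def)
  then have "\<not> E (P ! p) h"
    using p(1) E_sym by (auto simp: T_def X_def)
  let ?A = "{i \<in> T. \<not> E (P ! p) (P ! Suc i)}" and ?B = "{i \<in> T. \<not> E (P ! Suc p) (P ! Suc i)}"
  let ?T = "{i \<in> T. E (P ! p) (P ! Suc i) \<and> E (P ! Suc p) (P ! Suc i)}"
  \<comment> \<open>At most \<open>k - 2\<close> and \<open>k - 1\<close> positions are lost; at
    least two of the \<open>2 * k - 1\<close> remain.\<close>
  have AB: "card ?A + 1 < k" "card ?B < k"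
    using few_T[OF p(2)] few_T[OF p(3)] \<open>\<not> E (P ! p) h\<close> by simp_all
  have "T - ?T = ?A \<union> ?B"
    by auto
  then have few: "card (T - ?T) \<le> card ?A + card ?B"
    by (simp add: card_Un_le)
  show False
  proof (rule two_common)
    show "card (T - ?T) + 2 \<le> card T"
      using few AB T_large by linarith
    show False if "i \<in> ?T" "j \<in> ?T" "i < j" for i j
      using no_common_successor_neighbours[OF that(3) _ p(1) _ _ h] that pT by (auto simp: T_def X_def)
  qed auto
qed

end

theorem mainTheorem1:
  fixes V :: "'a set" and E :: "'a \<Rightarrow> 'a \<Rightarrow> bool" and k :: nat
  assumes "simple_graph V E"
    and "k \<ge> 1"
    and "k_connected V E (2 * k)"
    and "H_free V E (P2_kP1_V k) P2_kP1_E"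
    and "toughness V E > 1"
  shows "hamiltonian_connected V E"
  unfolding hamiltonian_connected_def
proof (intro ballI impI)
  fix a b
  assume ab: "a \<in> V" "b \<in> V" "a \<noteq> b"
  let ?path = "\<lambda>Q. is_walk E Q \<and> distinct Q \<and> set Q \<subseteq> V \<and> hd Q = a \<and> last Q = b"
  have finV: "finite V"
    using assms(1) by (simp add: simple_graph_def)
  \<comment> \<open>As \<open>2 * k > 0\<close>, the empty set is an admissible deletion.\<close>
  have "connected_graph V E"
    using assms(2,3) unfolding k_connected_def by (auto dest!: spec[of _ "{}"])
  then have "reach_in V E a b"
    using ab by (auto simp: connected_graph_def)
  then obtain Q where "?path Q"
    using is_walk_imp_path unfolding reach_in_def by (metis subset_trans)
  moreover have "length Q < Suc (card V)" if "?path Q" for Q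
    using that finV card_mono[of V "set Q"] by (auto simp: distinct_card less_Suc_eq_le)
  \<comment> \<open>A longest path exists because the lengths are bounded by
    \<open>card V\<close>.\<close>
  ultimately obtain P where P: "?path P" and max: "\<And>Q. ?path Q \<Longrightarrow> length Q \<le> length P"
    using ex_has_greatest_nat[of ?path Q length "Suc (card V)"] by metis
  interpret longest_path V E P
    using assms(1) P max by unfold_locales auto
  have "Suc 0 < length P"
  proof (rule ccontr)
    assume "\<not> Suc 0 < length P"
    then have "\<exists>x. P = [x]"
      using P by (cases P) (auto simp: is_walk_def)
    then show False
      using P ab(3) by auto
  qed
  then have "set P = V"
    using tough_imp_hamiltonian assms by blast
  then show "\<exists>xs. is_walk E xs \<and> distinct xs \<and> set xs = V \<and> hd xs = a \<and> last xs = b"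
    using P by blast
qed

end
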